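(* Let $\mathbb{F}$ be an arbitrary field, let $n$ be a positive integer, and let $A \in \mathrm{M}_n(\mathbb{F})$ be a square matrix with trace zero. Then $A$ is the sum of four square-zero matrices of $\mathrm{M}_n(\mathbb{F})$.
   Context: $\mathrm{M}_n(\mathbb{F})$ denotes the algebra of all $n \times n$ matrices with entries in $\mathbb{F}$. A matrix $S \in \mathrm{M}_n(\mathbb{F})$ is called square-zero if $S^2=0$ (the zero matrix is allowed). *)

theory Defs
  imports "Jordan_Normal_Form.Matrix"
begin

(* Matrix indices run over 0, ..., n - 1; meant for square matrices. *)
definition mat_trace :: "'a :: comm_monoid_add mat \<Rightarrow> 'a" where
  "mat_trace A = (\<Sum>i<dim_row A. A $$ (i, i))"

definition square_zero_mat :: "nat \<Rightarrow> 'a :: semiring_1 mat \<Rightarrow> bool" where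
  "square_zero_mat n S \<longleftrightarrow> S \<in> carrier_mat n n \<and> S ^\<^sub>m 2 = 0\<^sub>m n n"

end

theory Submission
  imports Defs "Jordan_Normal_Form.Jordan_Normal_Form_Existence"
begin

text \<open>
  The number four arises as two plus two: every matrix with zero trace is a sum of two matrices,
  each of which is a sum of two square-zero matrices.

  The basic source of sums of two square-zero matrices is the following: if the nonzero entries of
  a matrix join only indices of different parity, then the part in its even rows and the part in
  its odd rows are both square-zero (\<open>sum_of_two_square_zero_bipartite\<close>). Being such a sum is invariant under
  similarity, and a strictly triangular matrix is similar to its Jordan form, whose nonzero entries
  lie on the superdiagonal; hence every strictly triangular matrix is a sum of two square-zero
  matrices. So a matrix with zero diagonal, being the sum of its strictly upper and its
  strictly lower part, is a sum of four.

  A non-scalar matrix with zero trace is similar to one with zero diagonal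
  (\<open>nonscalar_similar_zero_diagonal\<close>, a theorem of Fillmore). Elementary conjugations clear
  the diagonal from the top: a nonzero entry below the current diagonal position makes it possible
  to annihilate that position, and it also lets one create a nonzero entry below the next
  position. The last diagonal entry then vanishes because the trace does.

  There remain the scalar matrices \<open>c I\<close> with \<open>n c = 0\<close>, which are similar only to
  themselves. If \<open>c \<noteq> 0\<close> and the characteristic is 2, then \<open>n\<close> is even; for the permutation
  matrix \<open>P\<close> of the reversal of indices, \<open>c I = c (I + P) + c P\<close> (\<open>scalar_sum_of_four_char_2\<close>),
  where \<open>I + P\<close> is square-zero because \<open>P\<^sup>2 = I\<close>, and \<open>P\<close> changes the parity of indices.
  In any other characteristic, \<open>c I\<close> splits into the diagonal matrices with entries
  \<open>(k + 1/2) c\<close> and \<open>(1/2 - k) c\<close>. Since \<open>n c = 0\<close>, in each of them the diagonal entries are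
  permuted by \<open>x \<mapsto> - x\<close>, and such a diagonal matrix is a sum of two square-zero matrices
  (\<open>sum_of_two_square_zero_antisymmetric_diagonal\<close>).
\<close>

definition sum_of_two_square_zero :: "nat \<Rightarrow> 'a :: semiring_1 mat \<Rightarrow> bool" where
  "sum_of_two_square_zero n A \<longleftrightarrow>
     (\<exists>S T. square_zero_mat n S \<and> square_zero_mat n T \<and> A = S + T)"

section \<open>Square-zero matrices\<close>

lemma square_zero_mat_iff:
  "square_zero_mat n S \<longleftrightarrow> S \<in> carrier_mat n n \<and> S * S = 0\<^sub>m n n"
  unfolding square_zero_mat_def by (auto simp: numeral_2_eq_2)

lemma square_zero_mat_mat:
  "square_zero_mat n (mat n n f) \<longleftrightarrow>
     (\<forall>i<n. \<forall>j<n. (\<Sum>k<n. f (i, k) * f (k, j)) = 0)"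
  unfolding square_zero_mat_iff
  by (auto simp: mat_eq_iff scalar_prod_def lessThan_atLeast0)

lemma similar_mat_conjugateE:
  assumes "similar_mat A B" "A \<in> carrier_mat n n"
  obtains P Q where "P \<in> carrier_mat n n" "Q \<in> carrier_mat n n" "B \<in> carrier_mat n n"
    "P * Q = 1\<^sub>m n" "Q * P = 1\<^sub>m n" "A = P * B * Q"
proof -
  from assms(1) obtain P Q where "similar_mat_wit A B P Q" unfolding similar_mat_def by blast
  from similar_mat_witD2[OF assms(2) this] that show ?thesis by blast
qed

lemma square_zero_mat_conjugate:
  fixes S :: "'a :: ring_1 mat"
  assumes S: "square_zero_mat n S" and P: "P \<in> carrier_mat n n" and Q: "Q \<in> carrier_mat n n"
    and QP: "Q * P = 1\<^sub>m n"
  shows "square_zero_mat n (P * S * Q)"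
proof -
  from S have Sc: "S \<in> carrier_mat n n" and SS: "S * S = 0\<^sub>m n n"
    by (auto simp: square_zero_mat_iff)
  have "(P * S * Q) * (P * S * Q) = P * S * (Q * P) * S * Q"
    using P Q Sc by (simp add: assoc_mult_mat[of _ n n _ n _ n])
  also have "\<dots> = P * (S * S) * Q"
    using P Q Sc unfolding QP by (simp add: assoc_mult_mat[of _ n n _ n _ n])
  also have "\<dots> = 0\<^sub>m n n" using P Q unfolding SS by simp
  finally show ?thesis using P Q Sc by (simp add: square_zero_mat_iff)
qed

lemma square_zero_mat_transpose:
  fixes S :: "'a :: comm_ring_1 mat"
  assumes "square_zero_mat n S"
  shows "square_zero_mat n (transpose_mat S)"
proof -
  from assms have S: "S \<in> carrier_mat n n" and SS: "S * S = 0\<^sub>m n n"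
    by (auto simp: square_zero_mat_iff)
  have "transpose_mat S * transpose_mat S = transpose_mat (S * S)"
    using transpose_mult[OF S S] by simp
  with SS S show ?thesis by (simp add: square_zero_mat_iff)
qed

section \<open>Sums of two square-zero matrices\<close>

lemma sum_of_two_square_zero_transpose:
  fixes A :: "'a :: comm_ring_1 mat"
  assumes "sum_of_two_square_zero n A"
  shows "sum_of_two_square_zero n (transpose_mat A)"
proof -
  from assms obtain S T where ST: "square_zero_mat n S" "square_zero_mat n T" and A: "A = S + T"
    unfolding sum_of_two_square_zero_def by blast
  hence "transpose_mat A = transpose_mat S + transpose_mat T"
    by (auto simp: square_zero_mat_iff transpose_add[of S n n T])
  with ST square_zero_mat_transpose show ?thesis unfolding sum_of_two_square_zero_def by blast
qed

lemma sum_of_two_square_zero_similar: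
  fixes A :: "'a :: ring_1 mat"
  assumes sim: "similar_mat A B" and A: "A \<in> carrier_mat n n" and B: "sum_of_two_square_zero n B"
  shows "sum_of_two_square_zero n A"
proof -
  from similar_mat_conjugateE[OF sim A] obtain P Q
    where P: "P \<in> carrier_mat n n" and Q: "Q \<in> carrier_mat n n"
      and QP: "Q * P = 1\<^sub>m n" and AB: "A = P * B * Q" .
  from B obtain S T where S: "square_zero_mat n S" and T: "square_zero_mat n T" and BST: "B = S + T"
    unfolding sum_of_two_square_zero_def by blast
  have Sc: "S \<in> carrier_mat n n" and Tc: "T \<in> carrier_mat n n"
    using S T by (auto simp: square_zero_mat_iff)
  have "A = P * S * Q + P * T * Q"
    unfolding AB BST using P Q Sc Tc
    by (simp add: mult_add_distrib_mat[of _ n n _ n] add_mult_distrib_mat[of _ n n _ _ n])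
  with square_zero_mat_conjugate[OF S P Q QP] square_zero_mat_conjugate[OF T P Q QP]
  show ?thesis unfolding sum_of_two_square_zero_def by blast
qed

text \<open>A product of two entries in even rows has the form \<open>a(i,k) a(k,j)\<close> with \<open>i\<close> and \<open>k\<close> even, so its
  first factor vanishes. The same holds for the odd rows.\<close>

lemma sum_of_two_square_zero_bipartite:
  fixes A :: "'a :: ring_1 mat"
  assumes A: "A \<in> carrier_mat n n"
    and bip: "\<And>i j. i < n \<Longrightarrow> j < n \<Longrightarrow> even i \<longleftrightarrow> even j \<Longrightarrow> A $$ (i, j) = 0"
  shows "sum_of_two_square_zero n A"
proof -
  let ?S = "\<lambda>b. mat n n (\<lambda>(i, j). if even i = b then A $$ (i, j) else 0)"
  have sq: "square_zero_mat n (?S b)" for b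
    unfolding square_zero_mat_mat by (auto intro!: sum.neutral simp: bip)
  have "A = ?S True + ?S False" using A by (auto simp: mat_eq_iff)
  with sq show ?thesis unfolding sum_of_two_square_zero_def by blast
qed

lemma jordan_matrix_off_superdiagonal:
  assumes "\<And>m a. (m, a) \<in> set n_as \<Longrightarrow> a = 0"
    and "i < sum_list (map fst n_as)" "j < sum_list (map fst n_as)" "j \<noteq> Suc i"
  shows "jordan_matrix n_as $$ (i, j) = 0"
  using assms
proof (induction n_as arbitrary: i j)
  case (Cons na n_as)
  obtain m a where na: "na = (m, a)" by force
  with Cons.prems(1)[of m a] have a: "a = 0" by simp
  have a0: "a' = 0" if "(m', a') \<in> set n_as" for m' a'
    using Cons.prems(1)[of m' a'] that by simp
  have IH: "jordan_matrix n_as $$ (i - m, j - m) = 0" if "m \<le> i" "m \<le> j"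
    by (rule Cons.IH[OF a0]) (use Cons.prems(2-4) that na in auto)
  show ?case
    using Cons.prems(2-4) IH a unfolding na jordan_matrix_Cons
    by (cases "i < m"; cases "j < m") simp_all
qed simp

text \<open>Over an arbitrary field a Jordan form need not exist, but a triangular matrix always has one.
  Here all its eigenvalues are zero, so only superdiagonal entries survive; they join consecutive
  indices, which have different parity.\<close>

lemma sum_of_two_square_zero_strictly_upper:
  fixes A :: "'a :: field mat"
  assumes A: "A \<in> carrier_mat n n"
    and up: "\<And>i j. i < n \<Longrightarrow> j < n \<Longrightarrow> j \<le> i \<Longrightarrow> A $$ (i, j) = 0"
  shows "sum_of_two_square_zero n A"
proof -
  have ut: "upper_triangular A" using A up by auto
  define n_as where "n_as = triangular_to_jnf_vector A"
  have jnf: "jordan_nf A n_as" unfolding n_as_def by (rule triangular_to_jnf_vector[OF A ut])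
  hence sim: "similar_mat A (jordan_matrix n_as)" and n0: "0 \<notin> fst ` set n_as"
    unfolding jordan_nf_def by auto
  have J: "jordan_matrix n_as \<in> carrier_mat n n"
    by (rule similar_mat_conjugateE[OF sim A])
  hence dim: "sum_list (map fst n_as) = n" by auto
  have diag: "diag_mat A = replicate n 0"
    using A up by (intro nth_equalityI) (auto simp: diag_mat_def)
  have cp: "char_poly A = [:0, 1:] ^ n"
    unfolding char_poly_upper_triangular[OF A ut] diag by simp
  have a0: "a = 0" if "(m, a) \<in> set n_as" for m a
  proof -
    have "0 < m" using that n0 by force
    hence "order a (char_poly A) \<noteq> 0" using jordan_nf_block_size_order_bound[OF jnf that] by simp
    hence "poly (char_poly A) a = 0" using order_root by blast
    thus ?thesis unfolding cp by simp
  qed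
  have "sum_of_two_square_zero n (jordan_matrix n_as)"
    using jordan_matrix_off_superdiagonal[of n_as] a0 dim
    by (intro sum_of_two_square_zero_bipartite[OF J]) (metis even_Suc)
  from sum_of_two_square_zero_similar[OF sim A this] show ?thesis .
qed

lemma zero_diagonal_sum_of_four:
  fixes A :: "'a :: field mat"
  assumes A: "A \<in> carrier_mat n n" and diag: "\<And>i. i < n \<Longrightarrow> A $$ (i, i) = 0"
  shows "\<exists>U L. sum_of_two_square_zero n U \<and> sum_of_two_square_zero n L \<and> A = U + L"
proof -
  let ?U = "mat n n (\<lambda>(i, j). if i < j then A $$ (i, j) else 0)"
  let ?L = "mat n n (\<lambda>(i, j). if j < i then A $$ (i, j) else 0)"
  have U: "sum_of_two_square_zero n ?U"
    by (rule sum_of_two_square_zero_strictly_upper) auto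
  have "sum_of_two_square_zero n (transpose_mat ?L)"
    by (rule sum_of_two_square_zero_strictly_upper) auto
  from sum_of_two_square_zero_transpose[OF this] have L: "sum_of_two_square_zero n ?L" by simp
  have "A = ?U + ?L" using A diag by (auto simp: mat_eq_iff not_less dest: antisym)
  with U L show ?thesis by blast
qed

section \<open>Non-scalar matrices with zero trace\<close>

lemma mat_trace_mult_commute:
  fixes A :: "'a :: comm_ring_1 mat"
  assumes "A \<in> carrier_mat n n" "B \<in> carrier_mat n n"
  shows "mat_trace (A * B) = mat_trace (B * A)"
proof -
  have "mat_trace (A * B) = (\<Sum>i<n. \<Sum>k<n. A $$ (i, k) * B $$ (k, i))"
    using assms by (auto simp: mat_trace_def scalar_prod_def lessThan_atLeast0 intro!: sum.cong)
  also have "\<dots> = (\<Sum>k<n. \<Sum>i<n. B $$ (k, i) * A $$ (i, k))"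
    by (subst sum.swap) (simp add: mult.commute)
  also have "\<dots> = mat_trace (B * A)"
    using assms by (auto simp: mat_trace_def scalar_prod_def lessThan_atLeast0 intro!: sum.cong)
  finally show ?thesis .
qed

lemma mat_trace_similar:
  fixes A :: "'a :: comm_ring_1 mat"
  assumes "similar_mat A B"
  shows "mat_trace A = mat_trace B"
proof -
  from similar_matD[OF assms] obtain n P Q where
    c: "A \<in> carrier_mat n n" "B \<in> carrier_mat n n" "P \<in> carrier_mat n n" "Q \<in> carrier_mat n n"
    and QP: "Q * P = 1\<^sub>m n" and A: "A = P * B * Q" by auto
  have "mat_trace A = mat_trace (P * (B * Q))"
    using c unfolding A by (simp add: assoc_mult_mat[of _ n n _ n _ n])
  also have "\<dots> = mat_trace (B * Q * P)" using c by (intro mat_trace_mult_commute) auto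
  also have "B * Q * P = B" using c QP by (simp add: assoc_mult_mat[of _ n n _ n _ n])
  finally show ?thesis .
qed

text \<open>One step of the clearing of the diagonal. All conjugations involve only rows and columns with
  index at least \<open>k\<close>, so the diagonal entries that are already zero stay zero. The nonzero entry
  below position \<open>k\<close> serves as a pivot three times: it annihilates the diagonal entry, it clears the
  entry below itself, and it produces a nonzero entry next to the following diagonal position,
  which is the pivot of the next step.\<close>

lemma similar_zero_diagonal_step:
  fixes A :: "'a :: field mat"
  assumes A: "A \<in> carrier_mat n n" and k: "Suc k < n" and nz: "A $$ (Suc k, k) \<noteq> 0"
    and diag: "\<And>i. i < k \<Longrightarrow> A $$ (i, i) = 0"
  obtains B where "B \<in> carrier_mat n n" "similar_mat A B" "\<And>i. i \<le> k \<Longrightarrow> B $$ (i, i) = 0"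
    "Suc (Suc k) < n \<Longrightarrow> B $$ (Suc (Suc k), Suc k) \<noteq> 0"
proof -
  define B where "B = add_col_sub_row (A $$ (k, k) / A $$ (Suc k, k)) k (Suc k) A"
  have B: "B \<in> carrier_mat n n" unfolding B_def using A by simp
  have AB: "similar_mat A B"
    unfolding B_def using A k by (intro similar_mat_sym[OF add_col_sub_row_similar]) auto
  have Bdiag: "B $$ (i, i) = 0" if "i \<le> k" for i
    unfolding B_def using A k nz diag that by (cases "i = k") auto
  have Bnz: "B $$ (Suc k, k) \<noteq> 0"
    unfolding B_def using A k nz by auto
  show ?thesis
  proof (cases "Suc (Suc k) < n")
    case False
    with B AB Bdiag that show ?thesis by blast
  next
    case k2: True
    (* With (k+2, k) cleared, adding column k to column k+2 and subtracting row k+2 from row k,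
       as is done for D, leaves the zero at (k, k) in place. *)
    define C where "C = add_col_sub_row (B $$ (Suc (Suc k), k) / B $$ (Suc k, k)) (Suc (Suc k)) (Suc k) B"
    have C: "C \<in> carrier_mat n n" unfolding C_def using B by simp
    have BC: "similar_mat B C"
      unfolding C_def using B k2 by (intro similar_mat_sym[OF add_col_sub_row_similar]) auto
    have Cdiag: "C $$ (i, i) = 0" if "i \<le> k" for i
      unfolding C_def using B k2 Bdiag that by auto
    have Cnz: "C $$ (Suc k, k) \<noteq> 0" and C0: "C $$ (Suc (Suc k), k) = 0"
      unfolding C_def using B k2 Bnz by auto
    define D where "D = (if C $$ (Suc k, Suc (Suc k)) = 0
      then add_col_sub_row 1 k (Suc (Suc k)) C else C)"
    have D: "D \<in> carrier_mat n n" unfolding D_def using C by simp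
    have CD: "similar_mat C D"
      unfolding D_def using C k2 similar_mat_refl[OF C]
      by (auto intro!: similar_mat_sym[OF add_col_sub_row_similar])
    have Ddiag: "D $$ (i, i) = 0" if "i \<le> k" for i
      unfolding D_def using C k2 Cdiag C0 that by auto
    have Dnz: "D $$ (Suc k, Suc (Suc k)) \<noteq> 0"
      unfolding D_def using C k2 Cnz by auto
    (* D has its nonzero entry above the diagonal; the swap moves it below. *)
    define E where "E = swap_cols_rows (Suc k) (Suc (Suc k)) D"
    have E: "E \<in> carrier_mat n n" unfolding E_def using D by simp
    have DE: "similar_mat D E"
      unfolding E_def using D k2 by (intro similar_mat_sym[OF swap_cols_rows_similar]) auto
    have Ediag: "E $$ (i, i) = 0" if "i \<le> k" for i
      unfolding E_def using D k2 Ddiag that by auto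
    have Enz: "E $$ (Suc (Suc k), Suc k) \<noteq> 0"
      unfolding E_def using D k2 Dnz by auto
    have "similar_mat A E"
      using AB BC CD DE by (meson similar_mat_trans)
    with E Ediag Enz that show ?thesis by blast
  qed
qed

lemma similar_zero_diagonal_from:
  fixes A :: "'a :: field mat"
  assumes "A \<in> carrier_mat n n" "mat_trace A = 0"
    and "Suc k < n" "A $$ (Suc k, k) \<noteq> 0" "\<And>i. i < k \<Longrightarrow> A $$ (i, i) = 0"
  shows "\<exists>B \<in> carrier_mat n n. similar_mat A B \<and> (\<forall>i<n. B $$ (i, i) = 0)"
  using assms
proof (induction "n - k" arbitrary: k A rule: less_induct)
  case less
  from similar_zero_diagonal_step[OF less.prems(1,3,4,5)] obtain B
    where B: "B \<in> carrier_mat n n" and AB: "similar_mat A B"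
      and diag: "\<And>i. i \<le> k \<Longrightarrow> B $$ (i, i) = 0"
      and nz: "Suc (Suc k) < n \<Longrightarrow> B $$ (Suc (Suc k), Suc k) \<noteq> 0" by blast
  have tr: "mat_trace B = 0" using mat_trace_similar[OF AB] less.prems(2) by simp
  show ?case
  proof (cases "Suc (Suc k) < n")
    case True
    have "\<exists>C \<in> carrier_mat n n. similar_mat B C \<and> (\<forall>i<n. C $$ (i, i) = 0)"
      using True less.prems(3) nz diag B tr by (intro less.hyps[of "Suc k"]) auto
    with similar_mat_trans[OF AB] show ?thesis by blast
  next
    case False
    with less.prems(3) have n: "n = Suc (Suc k)" by simp
    have "mat_trace B = (\<Sum>i<Suc k. B $$ (i, i)) + B $$ (Suc k, Suc k)"
      using B n by (simp add: mat_trace_def)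
    also have "(\<Sum>i<Suc k. B $$ (i, i)) = 0" using diag by (intro sum.neutral) auto
    finally have "B $$ (Suc k, Suc k) = 0" using tr by simp
    hence "\<forall>i<n. B $$ (i, i) = 0" using diag n by (auto simp: less_Suc_eq_le le_Suc_eq)
    with B AB show ?thesis by blast
  qed
qed

text \<open>If \<open>A\<close> is diagonal with two distinct diagonal entries, then adding one basis vector to
  the other makes their difference appear off the diagonal.\<close>

lemma nonscalar_similar_offdiagonal:
  fixes A :: "'a :: field mat"
  assumes A: "A \<in> carrier_mat n n" and ns: "\<And>c. A \<noteq> c \<cdot>\<^sub>m 1\<^sub>m n"
  obtains B i j where "B \<in> carrier_mat n n" "similar_mat A B" "i < n" "j < n" "i \<noteq> j"
    "B $$ (i, j) \<noteq> 0"
proof (cases "\<exists>i<n. \<exists>j<n. i \<noteq> j \<and> A $$ (i, j) \<noteq> 0")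
  case True
  with that[OF A similar_mat_refl[OF A]] show ?thesis by blast
next
  case False
  hence off: "\<And>i j. i < n \<Longrightarrow> j < n \<Longrightarrow> i \<noteq> j \<Longrightarrow> A $$ (i, j) = 0" by blast
  have "\<exists>i<n. A $$ (i, i) \<noteq> A $$ (0, 0)"
  proof (rule ccontr)
    assume "\<not> ?thesis"
    hence diag: "A $$ (i, i) = A $$ (0, 0)" if "i < n" for i using that by blast
    have "A = A $$ (0, 0) \<cdot>\<^sub>m 1\<^sub>m n"
    proof (rule eq_matI)
      fix i j assume "i < dim_row (A $$ (0, 0) \<cdot>\<^sub>m 1\<^sub>m n)" "j < dim_col (A $$ (0, 0) \<cdot>\<^sub>m 1\<^sub>m n)"
      with diag[of i] off[of i j] show "A $$ (i, j) = (A $$ (0, 0) \<cdot>\<^sub>m 1\<^sub>m n) $$ (i, j)"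
        by (cases "i = j") simp_all
    qed (use A in auto)
    with ns show False by blast
  qed
  then obtain i where i: "i < n" "A $$ (i, i) \<noteq> A $$ (0, 0)" by blast
  hence i0: "i \<noteq> 0" by metis
  let ?B = "add_col_sub_row 1 i 0 A"
  have "?B $$ (i, 0) \<noteq> 0" using A i i0 off by auto
  moreover have "similar_mat A ?B"
    using i i0 by (intro similar_mat_sym[OF add_col_sub_row_similar[OF A]]) auto
  moreover have "?B \<in> carrier_mat n n" using A by simp
  ultimately show ?thesis using that i i0 by blast
qed

lemma nonscalar_similar_zero_diagonal:
  fixes A :: "'a :: field mat"
  assumes A: "A \<in> carrier_mat n n" and tr: "mat_trace A = 0"
    and ns: "\<And>c. A \<noteq> c \<cdot>\<^sub>m 1\<^sub>m n"
  shows "\<exists>B \<in> carrier_mat n n. similar_mat A B \<and> (\<forall>i<n. B $$ (i, i) = 0)"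
proof -
  from nonscalar_similar_offdiagonal[OF A ns] obtain B i j where
    B: "B \<in> carrier_mat n n" and AB: "similar_mat A B" and ij: "i < n" "j < n" "i \<noteq> j"
    and Bij: "B $$ (i, j) \<noteq> 0" by blast
  (* Two swaps move the nonzero entry from (i, j) to (1, 0), where the clearing starts. If i = 0,
     the first swap has already moved row i to row j. *)
  define C where "C = swap_cols_rows 0 j B"
  define i' where "i' = (if i = 0 then j else i)"
  define D where "D = swap_cols_rows 1 i' C"
  have i': "i' < n" "i' \<noteq> 0" unfolding i'_def using ij by auto
  have C: "C \<in> carrier_mat n n" and D: "D \<in> carrier_mat n n"
    unfolding C_def D_def using B by simp_all
  have BC: "similar_mat B C"
    unfolding C_def using B ij by (intro similar_mat_sym[OF swap_cols_rows_similar]) auto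
  have CD: "similar_mat C D"
    unfolding D_def using C i' by (intro similar_mat_sym[OF swap_cols_rows_similar]) auto
  have "C $$ (i', 0) \<noteq> 0"
    unfolding C_def i'_def using B ij Bij by auto
  hence nz: "D $$ (Suc 0, 0) \<noteq> 0"
    unfolding D_def using C i' by auto
  have AD: "similar_mat A D" using AB BC CD by (meson similar_mat_trans)
  have trD: "mat_trace D = 0" using mat_trace_similar[OF AD] tr by simp
  have n: "Suc 0 < n" using i' by simp
  from similar_zero_diagonal_from[OF D trD n nz] similar_mat_trans[OF AD] show ?thesis by blast
qed

section \<open>Scalar matrices with zero trace\<close>

text \<open>The matrix is \<open>a + b P\<close>, where \<open>a\<close> and \<open>b\<close> are diagonal and \<open>P\<close> is the permutation matrix of the
  involution \<open>s\<close>. Since \<open>P\<close> moves past a diagonal matrix by permuting its entries with \<open>s\<close>, the two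
  hypotheses on \<open>a\<close> and \<open>b\<close> say that the diagonal part of the square and its
  coefficient of \<open>P\<close> vanish.\<close>

lemma square_zero_mat_diagonal_plus_involution:
  fixes a b :: "nat \<Rightarrow> 'a :: comm_ring_1"
  assumes s: "\<And>i. i < n \<Longrightarrow> s i < n" "\<And>i. i < n \<Longrightarrow> s (s i) = i"
    and diag: "\<And>i. i < n \<Longrightarrow> a i * a i + b i * b (s i) = 0"
    and perm: "\<And>i. i < n \<Longrightarrow> a i * b i + b i * a (s i) = 0"
  shows "square_zero_mat n
    (mat n n (\<lambda>(i, j). (if j = i then a i else 0) + (if j = s i then b i else 0)))"
  unfolding square_zero_mat_mat prod.case
proof (intro allI impI)
  fix i j assume i: "i < n" and j: "j < n"
  define f where "f i j = (if j = i then a i else 0) + (if j = s i then b i else 0)" for i j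
  have "(\<Sum>k<n. f i k * f k j) =
    (\<Sum>k<n. if k = i then a i * f k j else 0) + (\<Sum>k<n. if k = s i then b i * f k j else 0)"
    unfolding sum.distrib[symmetric]
    by (intro sum.cong refl) (simp add: f_def[of i] distrib_right)
  also have "\<dots> = a i * f i j + b i * f (s i) j"
    using i s(1)[OF i] by simp
  also have "\<dots> = (if j = i then a i * a i + b i * b (s i) else 0) +
      (if j = s i then a i * b i + b i * a (s i) else 0)"
    using s(2)[OF i] by (simp add: f_def distrib_left)
  also have "\<dots> = 0" unfolding diag[OF i] perm[OF i] by simp
  finally show "(\<Sum>k<n. ((if k = i then a i else 0) + (if k = s i then b i else 0)) *
      ((if j = k then a k else 0) + (if j = s k then b k else 0))) = 0"
    unfolding f_def .
qed

text \<open>The diagonal matrix \<open>D\<close> anticommutes with the permutation matrix \<open>P\<close> of \<open>s\<close>, and \<open>P\<^sup>2 = I\<close>; hence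
  \<open>D + D P\<close> and \<open>D - D P\<close> are square-zero, and their sum is \<open>2 D\<close>.\<close>

lemma sum_of_two_square_zero_antisymmetric_diagonal:
  fixes d :: "nat \<Rightarrow> 'a :: field"
  assumes two: "(2 :: 'a) \<noteq> 0"
    and s: "\<And>i. i < n \<Longrightarrow> s i < n" "\<And>i. i < n \<Longrightarrow> s (s i) = i" "\<And>i. i < n \<Longrightarrow> d (s i) = - d i"
  shows "sum_of_two_square_zero n (mat n n (\<lambda>(i, j). if j = i then d i else 0))"
proof -
  let ?S = "\<lambda>e::'a. mat n n (\<lambda>(i, j).
    (if j = i then d i / 2 else 0) + (if j = s i then e * (d i / 2) else 0))"
  have sq: "square_zero_mat n (?S e)" if e: "e * e = 1" for e
  proof (rule square_zero_mat_diagonal_plus_involution[OF s(1,2)])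
    fix i assume i: "i < n"
    have "d i / 2 * (d i / 2) + e * (d i / 2) * (e * (d (s i) / 2))
        = (1 - e * e) * (d i / 2 * (d i / 2))"
      unfolding s(3)[OF i] by (simp add: algebra_simps)
    thus "d i / 2 * (d i / 2) + e * (d i / 2) * (e * (d (s i) / 2)) = 0" using e by simp
    show "d i / 2 * (e * (d i / 2)) + e * (d i / 2) * (d (s i) / 2) = 0"
      unfolding s(3)[OF i] by simp
  qed
  have half: "d i / 2 + d i / 2 = d i" for i
    using two by (simp add: field_simps)
  have "mat n n (\<lambda>(i, j). if j = i then d i else 0) = ?S 1 + ?S (-1)"
    by (rule eq_matI) (auto simp: two half)
  with sq[of 1] sq[of "-1"] show ?thesis unfolding sum_of_two_square_zero_def by auto
qed

text \<open>The condition \<open>n c = 0\<close> makes the multiples of \<open>c\<close> by indices periodic modulo \<open>n\<close>. Therefore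
  \<open>k \<mapsto> n - 1 - k\<close> negates \<open>(k + 1/2) c\<close>, and \<open>k \<mapsto> 1 - k\<close>, taken modulo \<open>n\<close>, negates
  \<open>(1/2 - k) c\<close>. The bound \<open>1 < n\<close> keeps the index 1 in range.\<close>

lemma scalar_sum_of_four_char_not_2:
  fixes c :: "'a :: field"
  assumes two: "(2 :: 'a) \<noteq> 0" and n: "1 < n" and nc: "of_nat n * c = 0"
  shows "\<exists>U L. sum_of_two_square_zero n U \<and> sum_of_two_square_zero n L \<and> c \<cdot>\<^sub>m 1\<^sub>m n = U + L"
proof -
  let ?d = "\<lambda>k. (of_nat k + 1 / 2) * c"
  let ?e = "\<lambda>k. (1 / 2 - of_nat k) * c"
  let ?t = "\<lambda>k. if k \<le> 1 then 1 - k else n + 1 - k"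
  let ?U = "mat n n (\<lambda>(i, j). if j = i then ?d i else 0)"
  let ?L = "mat n n (\<lambda>(i, j). if j = i then ?e i else 0)"
  have half: "(1 / 2 + 1 / 2 :: 'a) = 1" using two by (simp add: field_simps)
  have "sum_of_two_square_zero n ?U"
  proof (rule sum_of_two_square_zero_antisymmetric_diagonal[OF two, where s = "\<lambda>k. n - 1 - k"])
    fix k assume k: "k < n"
    have "n = n - 1 - k + k + 1" using k by simp
    hence "of_nat n = of_nat (n - 1 - k) + of_nat k + (1 :: 'a)" by (metis of_nat_1 of_nat_add)
    hence "?d (n - 1 - k) + ?d k = (of_nat n - 1 + (1 / 2 + 1 / 2)) * c" by (simp add: algebra_simps)
    also have "\<dots> = 0" unfolding half using nc by simp
    finally show "?d (n - 1 - k) = - ?d k" by (simp add: eq_neg_iff_add_eq_0)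
  qed auto
  moreover have "sum_of_two_square_zero n ?L"
  proof (rule sum_of_two_square_zero_antisymmetric_diagonal[OF two, where s = ?t])
    fix k assume k: "k < n"
    show "?t k < n" "?t (?t k) = k" using k n by auto
    have "(of_nat (?t k) + of_nat k - 1) * c = 0"
    proof (cases "k \<le> 1")
      case True thus ?thesis by (auto simp: le_Suc_eq)
    next
      case False
      hence "n + 1 = ?t k + k" using k by simp
      hence "of_nat n + (1 :: 'a) = of_nat (?t k) + of_nat k" by (metis of_nat_1 of_nat_add)
      hence "of_nat (?t k) + of_nat k - 1 = (of_nat n :: 'a)" by (simp add: algebra_simps)
      thus ?thesis using nc by simp
    qed
    moreover have "?e (?t k) + ?e k = ((1 / 2 + 1 / 2) - of_nat (?t k) - of_nat k) * c"
      by (simp add: algebra_simps)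
    ultimately have "?e (?t k) + ?e k = 0" unfolding half by (simp add: algebra_simps)
    thus "?e (?t k) = - ?e k" by (simp add: eq_neg_iff_add_eq_0)
  qed
  moreover have "c \<cdot>\<^sub>m 1\<^sub>m n = ?U + ?L"
  proof -
    have "?d k + ?e k = (1 / 2 + 1 / 2) * c" for k by (simp add: algebra_simps)
    hence "?d k + ?e k = c" for k unfolding half by simp
    thus ?thesis by (auto simp: mat_eq_iff)
  qed
  ultimately show ?thesis by blast
qed

lemma scalar_sum_of_four_char_2:
  fixes c :: "'a :: field"
  assumes two: "(2 :: 'a) = 0" and n: "even n"
  shows "\<exists>U L. sum_of_two_square_zero n U \<and> sum_of_two_square_zero n L \<and> c \<cdot>\<^sub>m 1\<^sub>m n = U + L"
proof -
  have self: "x + x = 0" for x :: 'a using two by (metis mult_2 mult_zero_left)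
  let ?r = "\<lambda>i. n - 1 - i"
  let ?U = "mat n n (\<lambda>(i, j). (if j = i then c else 0) + (if j = ?r i then c else 0))"
  let ?L = "mat n n (\<lambda>(i, j). if j = ?r i then c else 0)"
  have "square_zero_mat n ?U"
    by (rule square_zero_mat_diagonal_plus_involution) (auto simp: self)
  moreover have "square_zero_mat n (0\<^sub>m n n :: 'a mat)" by (simp add: square_zero_mat_iff)
  moreover have "?U = ?U + 0\<^sub>m n n" by auto
  ultimately have "sum_of_two_square_zero n ?U" unfolding sum_of_two_square_zero_def by blast
  moreover have "sum_of_two_square_zero n ?L"
    using n by (intro sum_of_two_square_zero_bipartite) auto
  moreover have "c \<cdot>\<^sub>m 1\<^sub>m n = ?U + ?L"
    using self by (auto simp: mat_eq_iff add.assoc)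
  ultimately show ?thesis by blast
qed

lemma scalar_sum_of_four:
  fixes c :: "'a :: field"
  assumes n: "n > 0" and nc: "of_nat n * c = 0"
  shows "\<exists>U L. sum_of_two_square_zero n U \<and> sum_of_two_square_zero n L \<and> c \<cdot>\<^sub>m 1\<^sub>m n = U + L"
proof (cases "c = 0")
  case True
  show ?thesis unfolding True by (rule zero_diagonal_sum_of_four) auto
next
  case False
  with nc have n0: "of_nat n = (0 :: 'a)" by simp
  show ?thesis
  proof (cases "(2 :: 'a) = 0")
    case True
    have "even n"
    proof (rule ccontr)
      assume "odd n"
      then obtain m where "n = 2 * m + 1" by (rule oddE)
      with True n0 show False by simp
    qed
    with scalar_sum_of_four_char_2 True show ?thesis by blast
  next
    case two: False
    have "n \<noteq> 1" using n0 by auto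
    with n scalar_sum_of_four_char_not_2[OF two _ nc] show ?thesis by simp
  qed
qed

section \<open>Matrices with zero trace\<close>

lemma trace_zero_sum_of_two_pairs:
  fixes A :: "'a :: field mat"
  assumes n: "n > 0" and A: "A \<in> carrier_mat n n" and tr: "mat_trace A = 0"
  shows "\<exists>U L. sum_of_two_square_zero n U \<and> sum_of_two_square_zero n L \<and> A = U + L"
proof (cases "\<exists>c. A = c \<cdot>\<^sub>m 1\<^sub>m n")
  case True
  then obtain c where c: "A = c \<cdot>\<^sub>m 1\<^sub>m n" ..
  hence "of_nat n * c = 0" using tr by (simp add: mat_trace_def)
  from scalar_sum_of_four[OF n this] show ?thesis unfolding c .
next
  case False
  hence "\<And>c. A \<noteq> c \<cdot>\<^sub>m 1\<^sub>m n" by blast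
  from nonscalar_similar_zero_diagonal[OF A tr this] obtain B where
    B: "B \<in> carrier_mat n n" and AB: "similar_mat A B" and diag: "\<And>i. i < n \<Longrightarrow> B $$ (i, i) = 0"
    by blast
  from zero_diagonal_sum_of_four[OF B diag] obtain U L where
    U: "sum_of_two_square_zero n U" and L: "sum_of_two_square_zero n L" and BUL: "B = U + L" by blast
  have Uc: "U \<in> carrier_mat n n" and Lc: "L \<in> carrier_mat n n"
    using U L unfolding sum_of_two_square_zero_def square_zero_mat_iff by auto
  from similar_mat_conjugateE[OF AB A] obtain P Q
    where P: "P \<in> carrier_mat n n" and Q: "Q \<in> carrier_mat n n"
      and PQ: "P * Q = 1\<^sub>m n" and QP: "Q * P = 1\<^sub>m n" and APQ: "A = P * B * Q" .
  have conj: "sum_of_two_square_zero n (P * X * Q)"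
    if X: "sum_of_two_square_zero n X" "X \<in> carrier_mat n n" for X
  proof (rule sum_of_two_square_zero_similar[OF _ _ X(1)])
    show "similar_mat (P * X * Q) X"
      using P Q X(2) by (intro similar_matI[OF _ PQ QP refl]) auto
    show "P * X * Q \<in> carrier_mat n n" using P Q X(2) by simp
  qed
  have "A = P * U * Q + P * L * Q"
    unfolding APQ BUL using P Q Uc Lc
    by (simp add: mult_add_distrib_mat[of _ n n _ n] add_mult_distrib_mat[of _ n n _ _ n])
  with conj[OF U Uc] conj[OF L Lc] show ?thesis by blast
qed

theorem theorem1p1:
  fixes A :: "'a :: field mat" and n :: nat
  assumes "n > 0"
    and "A \<in> carrier_mat n n"
    and "mat_trace A = 0"
  shows "\<exists>S\<^sub>1 S\<^sub>2 S\<^sub>3 S\<^sub>4. square_zero_mat n S\<^sub>1 \<and> square_zero_mat n S\<^sub>2 \<and>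
           square_zero_mat n S\<^sub>3 \<and> square_zero_mat n S\<^sub>4 \<and> A = S\<^sub>1 + S\<^sub>2 + S\<^sub>3 + S\<^sub>4"
proof -
  from trace_zero_sum_of_two_pairs[OF assms] obtain S\<^sub>1 S\<^sub>2 S\<^sub>3 S\<^sub>4 where
    S: "square_zero_mat n S\<^sub>1" "square_zero_mat n S\<^sub>2" "square_zero_mat n S\<^sub>3" "square_zero_mat n S\<^sub>4"
    and A: "A = (S\<^sub>1 + S\<^sub>2) + (S\<^sub>3 + S\<^sub>4)"
    unfolding sum_of_two_square_zero_def by blast
  have "A = S\<^sub>1 + S\<^sub>2 + S\<^sub>3 + S\<^sub>4"
    using S unfolding A square_zero_mat_iff by (auto simp: assoc_add_mat[of _ n n])
  with S show ?thesis by blast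
qed

end
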